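(* Let $S$ be a regular group-bound semigroup all of whose $\mathcal{D}$-classes are finite. Then for all $x,y\in S$ we have $x\sim y$ if and only if $x\equiv y$.
   Context: $S^1$ denotes $S$ with an identity element adjoined if $S$ has none (and $S^1=S$ otherwise). $\mathcal{D}$ is Green's relation. A semigroup $S$ is group-bound if for each $x\in S$ there is $k\in\{1,2,\dots\}$ such that $x^k$ lies in a subgroup of $S$. Conjugacy $\sim$: for $x,y\in S$ write $x\sim_p y$ if there are $u,v\in S^1$ such that $x=uv$ and $y=vu$. The relation $\sim$ on $S$ is the transitive closure of $\sim_p$. Conjugacy in the character sense $\equiv$: a finite-dimensional complex representation of $S$ is a semigroup homomorphism $\varphi:S\to\mathrm{End}_{\mathbb{C}}(V)$ with $V$ a finite-dimensional complex vector space; its character is $\chi_\varphi(s)=\mathrm{trace}(\varphi(s))$, $s\in S$. Write $x\equiv y$ if $\chi_\varphi(x)=\chi_\varphi(y)$ for every finite-dimensional complex representation $\varphi$ of $S$. *)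

theory Defs
  imports
    "HOL-Algebra.Group"
    "Jordan_Normal_Form.Matrix"
begin

text \<open>
  The ambient semigroup is a type of class \<open>semigroup_mult\<close>.
\<close>

section \<open>The monoid obtained by adjoining an identity\<close>

text \<open>
  Elements of the semigroup \<open>S\<close> are embedded in \<open>S\<^sup>1\<close> by \<open>Some\<close>; \<open>None\<close> is the adjoined
  identity, and it belongs to the carrier only if \<open>S\<close> has no identity element of its own.
\<close>

definition has_identity :: "'a::semigroup_mult itself \<Rightarrow> bool" where
  "has_identity _ \<longleftrightarrow> (\<exists>e::'a. \<forall>x. e * x = x \<and> x * e = x)"

definition adj_carrier :: "'a::semigroup_mult option set" where
  "adj_carrier = (if has_identity TYPE('a) then range Some else UNIV)"

fun adj_mult :: "'a::semigroup_mult option \<Rightarrow> 'a option \<Rightarrow> 'a option" (infixl "\<odot>" 70) where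
  "None \<odot> v = v"
| "u \<odot> None = u"
| "Some a \<odot> Some b = Some (a * b)"

section \<open>Green's relations\<close>

definition principal_left_ideal :: "'a::semigroup_mult \<Rightarrow> 'a set" where
  "principal_left_ideal x = {y. \<exists>u\<in>adj_carrier. Some y = u \<odot> Some x}"

definition principal_right_ideal :: "'a::semigroup_mult \<Rightarrow> 'a set" where
  "principal_right_ideal x = {y. \<exists>u\<in>adj_carrier. Some y = Some x \<odot> u}"

definition green_L :: "'a::semigroup_mult \<Rightarrow> 'a \<Rightarrow> bool" where
  "green_L x y \<longleftrightarrow> principal_left_ideal x = principal_left_ideal y"

definition green_R :: "'a::semigroup_mult \<Rightarrow> 'a \<Rightarrow> bool" where
  "green_R x y \<longleftrightarrow> principal_right_ideal x = principal_right_ideal y"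

definition green_D :: "'a::semigroup_mult \<Rightarrow> 'a \<Rightarrow> bool" where
  "green_D = green_L OO green_R"

section \<open>Regular and group-bound elements\<close>

definition regular_element :: "'a::semigroup_mult \<Rightarrow> bool" where
  "regular_element a \<longleftrightarrow> (\<exists>b. a * b * a = a)"

text \<open>The power \<open>x\<^sup>k\<close> for \<open>k \<ge> 1\<close>; the value at \<open>k = 0\<close> is a dummy.\<close>

definition semigroup_power :: "'a::semigroup_mult \<Rightarrow> nat \<Rightarrow> 'a" where
  "semigroup_power x k = ((\<lambda>y. y * x) ^^ (k - 1)) x"

text \<open>A subgroup of a semigroup may have any idempotent as its identity element.\<close>

definition is_subgroup :: "'a::semigroup_mult set \<Rightarrow> bool" where
  "is_subgroup G \<longleftrightarrow> (\<exists>e. group \<lparr>carrier = G, monoid.mult = (*), one = e\<rparr>)"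

definition group_bound_element :: "'a::semigroup_mult \<Rightarrow> bool" where
  "group_bound_element x \<longleftrightarrow> (\<exists>k\<ge>1. \<exists>G. is_subgroup G \<and> semigroup_power x k \<in> G)"

section \<open>Conjugacy\<close>

definition primary_conj :: "'a::semigroup_mult \<Rightarrow> 'a \<Rightarrow> bool" (infix "\<sim>\<^sub>p" 50) where
  "x \<sim>\<^sub>p y \<longleftrightarrow> (\<exists>u\<in>adj_carrier. \<exists>v\<in>adj_carrier. Some x = u \<odot> v \<and> Some y = v \<odot> u)"

definition semigroup_conj :: "'a::semigroup_mult \<Rightarrow> 'a \<Rightarrow> bool" (infix "\<sim>" 50) where
  "semigroup_conj = primary_conj\<^sup>+\<^sup>+"

section \<open>Conjugacy in the character sense\<close>

text \<open>
  A complex representation of dimension \<open>n\<close> is given in coordinates, by a homomorphism into the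
  multiplicative semigroup of complex \<open>n \<times> n\<close> matrices. No identity needs to be preserved, and
  \<open>n = 0\<close> is allowed.
\<close>

definition representation :: "nat \<Rightarrow> ('a::semigroup_mult \<Rightarrow> complex mat) \<Rightarrow> bool" where
  "representation n \<phi> \<longleftrightarrow>
     (\<forall>s. \<phi> s \<in> carrier_mat n n) \<and> (\<forall>s t. \<phi> (s * t) = \<phi> s * \<phi> t)"

definition mat_trace :: "complex mat \<Rightarrow> complex" where
  "mat_trace A = (\<Sum>i<dim_row A. A $$ (i, i))"

definition char_of :: "('a::semigroup_mult \<Rightarrow> complex mat) \<Rightarrow> 'a \<Rightarrow> complex" where
  "char_of \<phi> s = mat_trace (\<phi> s)"

definition char_conj :: "'a::semigroup_mult \<Rightarrow> 'a \<Rightarrow> bool" (infix "\<equiv>\<^sub>\<chi>" 50) where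
  "x \<equiv>\<^sub>\<chi> y \<longleftrightarrow> (\<forall>n \<phi>. representation n \<phi> \<longrightarrow> char_of \<phi> x = char_of \<phi> y)"

end

theory Submission
  imports Defs
begin

text \<open>
  By regularity every element \<open>x\<close> is conjugate to \<open>x e\<close>, where \<open>e\<close> is the identity of a subgroup
  containing a power of \<open>x\<close>; so \<open>x\<close> and \<open>y\<close> may be taken in subgroups with identities \<open>e\<close> and \<open>f\<close>.
  The \<open>\<L>\<close>-class \<open>L\<close> of \<open>e\<close> is finite, so \<open>x\<^sup>n = e\<close> for some \<open>n \<ge> 1\<close>. The semigroup acts on \<open>\<complex>L\<close>
  from the left by partial maps (products leaving \<open>L\<close> are replaced by \<open>0\<close>), and the right
  multiplication by \<open>x\<close> commutes with this action. Cutting \<open>\<complex>L\<close> down by the spectral idempotents of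
  this right multiplication gives representations whose characters at \<open>s\<close>, suitably weighted by
  \<open>n\<close>-th roots of unity, add up to the number of \<open>l \<in> L\<close> with \<open>s l = l x\<close>. For \<open>s = x\<close> this number is
  positive, as \<open>l = e\<close> shows. Hence \<open>x \<equiv> y\<close> yields \<open>l \<L> e\<close> with \<open>y l = l x\<close>, and by symmetry \<open>m \<L> f\<close>
  with \<open>x m = m y\<close>. Group-boundedness applied to \<open>l m\<close> then shows that \<open>l \<R> f\<close>, and this makes
  \<open>x\<close> and \<open>y\<close> conjugate.
\<close>

section \<open>Conjugacy\<close>

lemma adj_carrier_Some [simp]: "Some u \<in> adj_carrier"
  by (simp add: adj_carrier_def)

lemma primary_conj_mult: "u * v \<sim>\<^sub>p v * u"
  unfolding primary_conj_def by (rule bexI[of _ "Some u"], rule bexI[of _ "Some v"]) auto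

lemma primary_conj_sym: "x \<sim>\<^sub>p y \<Longrightarrow> y \<sim>\<^sub>p x"
  unfolding primary_conj_def by blast

text \<open>An adjoined identity as factor forces x = y; otherwise both factors lie in S
  itself.\<close>

lemma primary_conj_cases:
  assumes "x \<sim>\<^sub>p y"
  obtains "x = y" | u v where "x = u * v" "y = v * u"
proof -
  obtain u v where "Some x = u \<odot> v" "Some y = v \<odot> u"
    using assms unfolding primary_conj_def by blast
  then show thesis using that by (cases u; cases v) auto
qed

lemma semigroup_conj_mult: "u * v \<sim> v * u"
  unfolding semigroup_conj_def by (rule tranclp.r_into_trancl) (rule primary_conj_mult)

lemma semigroup_conj_trans [trans]: "x \<sim> y \<Longrightarrow> y \<sim> z \<Longrightarrow> x \<sim> z"
  unfolding semigroup_conj_def by (rule tranclp_trans)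

lemma semigroup_conj_sym: "x \<sim> y \<Longrightarrow> y \<sim> x"
  unfolding semigroup_conj_def
  by (induction rule: tranclp_induct) (auto intro: primary_conj_sym tranclp_into_tranclp2)

lemma mat_trace_mult_comm:
  assumes "A \<in> carrier_mat n n" "B \<in> carrier_mat n n"
  shows "mat_trace (A * B) = mat_trace (B * A)"
proof -
  have "mat_trace (A * B) = (\<Sum>i<n. \<Sum>j<n. A $$ (i, j) * B $$ (j, i))"
    using assms by (simp add: mat_trace_def scalar_prod_def atLeast0LessThan)
  also have "\<dots> = (\<Sum>j<n. \<Sum>i<n. A $$ (i, j) * B $$ (j, i))"
    by (rule sum.swap)
  also have "\<dots> = mat_trace (B * A)"
    using assms by (simp add: mat_trace_def scalar_prod_def atLeast0LessThan mult.commute)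
  finally show ?thesis .
qed

lemma primary_conj_imp_char_conj:
  assumes "x \<sim>\<^sub>p y"
  shows "x \<equiv>\<^sub>\<chi> y"
  using assms
proof (cases rule: primary_conj_cases)
  case 1
  then show ?thesis by (simp add: char_conj_def)
next
  case (2 u v)
  then show ?thesis
    by (auto simp: char_conj_def representation_def char_of_def intro: mat_trace_mult_comm)
qed

lemma char_conj_sym: "x \<equiv>\<^sub>\<chi> y \<Longrightarrow> y \<equiv>\<^sub>\<chi> x"
  by (simp add: char_conj_def)

lemma char_conj_trans [trans]: "x \<equiv>\<^sub>\<chi> y \<Longrightarrow> y \<equiv>\<^sub>\<chi> z \<Longrightarrow> x \<equiv>\<^sub>\<chi> z"
  by (simp add: char_conj_def)

lemma semigroup_conj_imp_char_conj: "x \<sim> y \<Longrightarrow> x \<equiv>\<^sub>\<chi> y"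
  unfolding semigroup_conj_def
  by (induction rule: tranclp_induct) (auto intro: primary_conj_imp_char_conj char_conj_trans)

section \<open>Reduction to elements of subgroups\<close>

text \<open>For x in the maximal subgroup with identity e. The witness z may lie outside it; the
  inverse of x is then \<open>e * z * e\<close>.\<close>

definition group_elem :: "'a::semigroup_mult \<Rightarrow> 'a \<Rightarrow> 'a \<Rightarrow> bool" where
  "group_elem e x z \<longleftrightarrow> e * e = e \<and> e * x = x \<and> x * e = x \<and> z * x = e \<and> x * z = e"

lemma semigroup_power_1 [simp]: "semigroup_power x (Suc 0) = x"
  by (simp add: semigroup_power_def)

lemma semigroup_power_Suc: "k \<ge> 1 \<Longrightarrow> semigroup_power x (Suc k) = semigroup_power x k * x"
  by (cases k) (simp_all add: semigroup_power_def)

lemma semigroup_power_Suc':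
  assumes "k \<ge> 1"
  shows "semigroup_power x (Suc k) = x * semigroup_power x k"
  using assms by (induction k rule: dec_induct) (simp_all add: semigroup_power_Suc mult.assoc)

lemma group_bound_elementE:
  assumes "group_bound_element x"
  obtains k e q where "k \<ge> 1" "group_elem e (semigroup_power x k) q"
proof -
  obtain k G e where k: "k \<ge> 1" "semigroup_power x k \<in> G"
    and G: "group \<lparr>carrier = G, monoid.mult = (*), one = e\<rparr>" (is "group ?G")
    using assms unfolding group_bound_element_def is_subgroup_def by blast
  interpret group ?G by (fact G)
  have "group_elem e (semigroup_power x k) (inv\<^bsub>?G\<^esub> (semigroup_power x k))"
    unfolding group_elem_def
    using k one_closed l_one r_one l_inv[of "semigroup_power x k"] r_inv[of "semigroup_power x k"]
    by simp
  with k show thesis using that by blast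
qed

text \<open>Induction on k with q arbitrary: regularity supplies an inner inverse of the lower
  power, unrelated to the given q, and one swap of factors exchanges the two.\<close>

lemma semigroup_conj_times_power_inverse:
  assumes regular: "\<And>a::'a::semigroup_mult. regular_element a"
    and "k \<ge> 1"
    and "semigroup_power x k * q * semigroup_power x k = semigroup_power x k"
  shows "x \<sim> x * (semigroup_power x k * (q::'a))"
  using assms(2,3)
proof (induction k arbitrary: q rule: dec_induct)
  case base
  then show ?case using semigroup_conj_mult[of "x * q" x] by simp
next
  case (step k)
  let ?p = "semigroup_power x k" and ?P = "semigroup_power x (Suc k)"
  obtain r where r: "?p * r * ?p = ?p"
    using regular[of ?p] by (auto simp: regular_element_def)
  have "x \<sim> x * (?p * r)" by (rule step.IH[OF r])
  \<comment> \<open>Since x p = P, the left side is P r, which P q fixes because P q P = P.\<close>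
  also have "x * (?p * r) = (?P * q) * (x * (?p * r))"
    using step.prems step.hyps by (metis mult.assoc semigroup_power_Suc')
  also have "\<dots> \<sim> (x * (?p * r)) * (?P * q)" by (rule semigroup_conj_mult)
  also have "\<dots> = x * ((?p * r * ?p) * x * q)"
    using step.hyps by (simp add: semigroup_power_Suc mult.assoc)
  also have "\<dots> = x * (?P * q)"
    using step.hyps r by (simp add: semigroup_power_Suc)
  finally show ?case .
qed

lemma semigroup_conj_group_elem:
  assumes regular: "\<And>a::'a::semigroup_mult. regular_element a"
    and "group_bound_element (x::'a)"
  obtains e x' z where "x \<sim> x'" "group_elem e x' z"
proof -
  obtain k e q where k: "k \<ge> 1" and g: "group_elem e (semigroup_power x k) q"
    using assms(2) by (rule group_bound_elementE)
  let ?X = "semigroup_power x k"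
  have e: "e * e = e" "e * ?X = ?X" "?X * e = ?X" "q * ?X = e" "?X * q = e"
    using g by (auto simp: group_elem_def)
  have X: "?X * x = x * ?X" using semigroup_power_Suc[OF k] semigroup_power_Suc'[OF k] by metis
  have "?X * q * ?X = ?X" by (simp add: e)
  then have conj: "x \<sim> x * e"
    using semigroup_conj_times_power_inverse[OF regular k, of x q] by (simp add: e)
  \<comment> \<open>As x commutes with X, x e = x X q = X x q is fixed by e on the left. Dually for
    e x, so x commutes with e.\<close>
  have xe: "e * x * e = x * e" by (metis X e mult.assoc)
  have ex: "e * x * e = e * x" by (metis X e mult.assoc)
  \<comment> \<open>One factor x is split off X; k = 1 is separate because S has no zeroth
    powers.\<close>
  have "\<exists>a b. a * x = e \<and> x * b = e"
  proof (cases "k = 1")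
    case True
    then show ?thesis using e by auto
  next
    case False
    then obtain j where j: "k = Suc j" "j \<ge> 1" using k by (cases k) auto
    show ?thesis
    proof (intro exI conjI)
      show "(q * semigroup_power x j) * x = e"
        using e(4) j by (simp add: semigroup_power_Suc mult.assoc)
      show "x * (semigroup_power x j * q) = e"
        using e(5) j by (simp add: semigroup_power_Suc' mult.assoc)
    qed
  qed
  then obtain a b where a: "a * x = e" and b: "x * b = e" by blast
  have "(e * a * e) * (x * e) = e" by (metis a e(1) ex xe mult.assoc)
  moreover have "(x * e) * (e * b * e) = e" by (metis b e(1) ex xe mult.assoc)
  moreover have "(e * a * e) * e = e * a * e" "e * (e * b * e) = e * b * e"
    using e(1) by (metis mult.assoc)+
  ultimately have "e * a * e = e * b * e" by (metis mult.assoc)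
  then have "(x * e) * (e * a * e) = e" using \<open>(x * e) * (e * b * e) = e\<close> by simp
  moreover have "e * (x * e) = x * e" "(x * e) * e = x * e"
    using xe e(1) by (simp_all add: mult.assoc)
  ultimately have "group_elem e (x * e) (e * a * e)"
    using \<open>(e * a * e) * (x * e) = e\<close> e(1) by (simp add: group_elem_def)
  with conj show thesis using that by blast
qed

section \<open>Monomial representations on an \<open>\<L>\<close>-class\<close>

text \<open>For idempotent e this is the L-class of e; multipliers from S suffice, since e itself
  replaces the adjoined identity.\<close>

definition L_class :: "'a::semigroup_mult \<Rightarrow> 'a set" where
  "L_class e = {b. b * e = b \<and> (\<exists>u. u * b = e)}"

lemma mem_principal_left_ideal_iff:
  "y \<in> principal_left_ideal x \<longleftrightarrow> y = x \<or> (\<exists>u. y = u * x)"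
proof -
  have "(\<exists>u\<in>adj_carrier. Some y = u \<odot> Some x) \<longleftrightarrow> y = x \<or> (\<exists>u. y = u * x)"
  proof (cases "has_identity TYPE('a)")
    case True
    then obtain i :: 'a where "\<forall>x. i * x = x" by (auto simp: has_identity_def)
    then show ?thesis using True by (auto simp: adj_carrier_def) metis
  next
    case False
    have "(\<exists>u. Some y = u \<odot> Some x) \<longleftrightarrow> y = x \<or> (\<exists>u. y = u * x)"
      by (metis adj_mult.simps(1,3) option.exhaust option.inject)
    then show ?thesis using False by (simp add: adj_carrier_def)
  qed
  then show ?thesis by (simp add: principal_left_ideal_def)
qed

lemma L_class_subset_green_D: "L_class e \<subseteq> {b. green_D e b}"
proof
  fix b assume "b \<in> L_class e"
  then obtain u where "b * e = b" "u * b = e" by (auto simp: L_class_def)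
  then have "principal_left_ideal e = principal_left_ideal b"
    by (auto simp: mem_principal_left_ideal_iff) (metis mult.assoc)+
  then show "b \<in> {b. green_D e b}"
    by (auto simp: green_D_def green_L_def green_R_def)
qed

lemma sum_periodic_shift:
  fixes F :: "nat \<Rightarrow> 'b::comm_monoid_add"
  assumes "\<And>m. F (m + n) = F m"
  shows "(\<Sum>m<n. F (m + k)) = (\<Sum>m<n. F m)"
proof (induction k)
  case (Suc k)
  have "(\<Sum>m<n. F (Suc m + k)) = (\<Sum>m<n. F (m + k))"
  proof (cases n)
    case (Suc l)
    have "F (n + k) = F k" using assms[of k] by (simp add: add.commute)
    then show ?thesis
      unfolding Suc by (subst sum.lessThan_Suc, subst sum.lessThan_Suc_shift) (simp add: add.commute)
  qed simp
  then show ?case using Suc by simp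
qed simp

text \<open>
  When \<open>g m = x\<^sup>m\<close> and \<open>w\<^sup>n = 1\<close>, these are the matrix entries of the left action of \<open>s\<close> on \<open>\<complex>L\<close>
  composed with the projection onto the eigenspace of right multiplication by \<open>x\<close> for the
  eigenvalue \<open>w\<^sup>-\<^sup>1\<close>.
\<close>

definition twisted_kernel ::
    "nat \<Rightarrow> complex \<Rightarrow> (nat \<Rightarrow> 'a::semigroup_mult) \<Rightarrow> 'a \<Rightarrow> 'a \<Rightarrow> 'a \<Rightarrow> complex" where
  "twisted_kernel n w g s a b = (\<Sum>m<n. w ^ m * of_bool (s * b * g m = a)) / of_nat n"

text \<open>The sequence g stands for the powers of a group element, with zeroth power e. Only g n =
  e is required, so n may be a multiple of the order.\<close>

locale cyclic_subgroup =
  fixes e :: "'a::semigroup_mult" and g :: "nat \<Rightarrow> 'a" and n :: nat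
  assumes n_pos: "n > 0"
    and g_0: "g 0 = e"
    and g_add: "g (m + k) = g m * g k"
    and g_n: "g n = e"
    and fin: "finite (L_class e)"
begin

lemma e_mult_g: "e * g m = g m"
  by (metis g_0 g_add add_0)

lemma g_mult_e: "g m * e = g m"
  by (metis g_0 g_add add_0_right)

text \<open>A product that has left the L-class cannot return: \<open>g m\<close> is cancelled by
  \<open>g (n - m)\<close>, which leaves e as a left multiple of the inner product. Hence the
  partial maps compose correctly.\<close>

lemma mult_g_in_L_class:
  assumes "b \<in> L_class e" "s * (t * b * g k) * g m \<in> L_class e" "m < n"
  shows "t * b * g k \<in> L_class e"
proof -
  obtain u where "u * (s * (t * b * g k) * g m) = e" using assms(2) by (auto simp: L_class_def)
  then have "u * s * (t * b * g k) * (g m * g (n - m)) = g (n - m)"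
    by (metis mult.assoc e_mult_g)
  moreover have "g m * g (n - m) = e"
    using assms(3) g_add[of m "n - m"] g_n by simp
  ultimately have "u * s * (t * b * g k) = g (n - m)" by (metis mult.assoc g_mult_e)
  then have "(g m * u * s) * (t * b * g k) = e"
    using \<open>g m * g (n - m) = e\<close> by (simp add: mult.assoc)
  moreover have "t * b * g k * e = t * b * g k" by (simp add: mult.assoc g_mult_e)
  ultimately show ?thesis unfolding L_class_def by blast
qed

lemma twisted_kernel_times_n:
  "twisted_kernel n w g s a b * of_nat n = (\<Sum>m<n. w ^ m * of_bool (s * b * g m = a))"
  using n_pos by (simp add: twisted_kernel_def)

text \<open>The left action commutes with the averaging projection. Each term of the double sum
  depends only on m + k modulo n, so idempotence of the projection becomes a shift of a periodic
  sum.\<close>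

lemma twisted_kernel_mult:
  assumes w: "w ^ n = 1" and ab: "a \<in> L_class e" "b \<in> L_class e"
  shows "(\<Sum>c\<in>L_class e. twisted_kernel n w g s a c * twisted_kernel n w g t c b)
    = twisted_kernel n w g (s * t) a b"
proof -
  let ?L = "L_class e"
  define F :: "nat \<Rightarrow> complex" where "F k = w ^ k * of_bool (s * t * b * g k = a)" for k
  have F: "F (m + n) = F m" for m
    by (simp add: F_def power_add w g_add g_n g_mult_e)
  have inner: "(\<Sum>c\<in>?L. (w ^ m * of_bool (s * c * g m = a)) * (w ^ k * of_bool (t * b * g k = c)))
      = F (m + k)" if "m < n" for m k
  proof -
    have "(\<Sum>c\<in>?L. (w ^ m * of_bool (s * c * g m = a)) * (w ^ k * of_bool (t * b * g k = c)))
      = (\<Sum>c\<in>?L. if c = t * b * g k then w ^ (m + k) * of_bool (s * c * g m = a) else 0)"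
      by (rule sum.cong) (auto simp: power_add)
    also have "\<dots> = (if t * b * g k \<in> ?L then w ^ (m + k) * of_bool (s * (t * b * g k) * g m = a) else 0)"
      using fin by simp
    \<comment> \<open>If the indicator is nonzero, the product equals a in L, so the intermediate
      point is in L too.\<close>
    also have "\<dots> = w ^ (m + k) * of_bool (s * (t * b * g k) * g m = a)"
      using mult_g_in_L_class[OF ab(2), of s t k m] that ab(1) by auto
    also have "s * (t * b * g k) * g m = s * t * b * g (m + k)"
      by (simp add: add.commute[of m] g_add mult.assoc)
    finally show ?thesis by (simp add: F_def)
  qed
  have "(\<Sum>c\<in>?L. twisted_kernel n w g s a c * twisted_kernel n w g t c b) * (of_nat n * of_nat n)
     = (\<Sum>c\<in>?L. (twisted_kernel n w g s a c * of_nat n) * (twisted_kernel n w g t c b * of_nat n))"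
    by (simp add: sum_distrib_left sum_distrib_right mult_ac)
  also have "\<dots> = (\<Sum>c\<in>?L. \<Sum>m<n. \<Sum>k<n.
          (w ^ m * of_bool (s * c * g m = a)) * (w ^ k * of_bool (t * b * g k = c)))"
    by (simp only: twisted_kernel_times_n sum_product)
  also have "\<dots> = (\<Sum>m<n. \<Sum>k<n. \<Sum>c\<in>?L.
          (w ^ m * of_bool (s * c * g m = a)) * (w ^ k * of_bool (t * b * g k = c)))"
    by (subst sum.swap, rule sum.cong[OF refl], rule sum.swap)
  also have "\<dots> = (\<Sum>m<n. \<Sum>k<n. F (k + m))"
    by (intro sum.cong refl) (simp only: inner lessThan_iff add.commute)
  also have "\<dots> = of_nat n * (\<Sum>k<n. F k)"
    by (simp add: sum_periodic_shift[of F n, OF F])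
  also have "\<dots> = of_nat n * (twisted_kernel n w g (s * t) a b * of_nat n)"
    by (simp only: twisted_kernel_times_n F_def)
  finally show ?thesis using n_pos by simp
qed

lemma char_conj_imp_sum_twisted_kernel_eq:
  assumes w: "w ^ n = 1" and xy: "x \<equiv>\<^sub>\<chi> y"
  shows "(\<Sum>b\<in>L_class e. twisted_kernel n w g x b b) = (\<Sum>b\<in>L_class e. twisted_kernel n w g y b b)"
proof -
  let ?N = "card (L_class e)"
  obtain h where h: "bij_betw h {..<?N} (L_class e)"
    using ex_bij_betw_nat_finite[OF fin] by (auto simp: atLeast0LessThan)
  have hL: "h i \<in> L_class e" if "i < ?N" for i
    using h that by (auto simp: bij_betw_def)
  define \<phi> where "\<phi> s = mat ?N ?N (\<lambda>(i, j). twisted_kernel n w g s (h i) (h j))" for s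
  have "\<phi> (s * t) = \<phi> s * \<phi> t" for s t
  proof (rule eq_matI)
    fix i j assume "i < dim_row (\<phi> s * \<phi> t)" "j < dim_col (\<phi> s * \<phi> t)"
    then have ij: "i < ?N" "j < ?N" by (auto simp: \<phi>_def)
    have "(\<phi> s * \<phi> t) $$ (i, j)
        = (\<Sum>k<?N. twisted_kernel n w g s (h i) (h k) * twisted_kernel n w g t (h k) (h j))"
      using ij by (simp add: \<phi>_def scalar_prod_def atLeast0LessThan)
    also have "\<dots> = (\<Sum>c\<in>L_class e. twisted_kernel n w g s (h i) c * twisted_kernel n w g t c (h j))"
      by (rule sum.reindex_bij_betw[OF h])
    also have "\<dots> = \<phi> (s * t) $$ (i, j)"
      using ij by (simp add: \<phi>_def twisted_kernel_mult w hL)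
    finally show "\<phi> (s * t) $$ (i, j) = (\<phi> s * \<phi> t) $$ (i, j)" by simp
  qed (auto simp: \<phi>_def)
  then have "representation ?N \<phi>" by (auto simp: representation_def \<phi>_def)
  then have "char_of \<phi> x = char_of \<phi> y" using xy by (auto simp: char_conj_def)
  moreover have "char_of \<phi> s = (\<Sum>b\<in>L_class e. twisted_kernel n w g s b b)" for s
    using sum.reindex_bij_betw[OF h, of "\<lambda>b. twisted_kernel n w g s b b"]
    by (simp add: char_of_def mat_trace_def \<phi>_def)
  ultimately show ?thesis by simp
qed

text \<open>Orthogonality of roots of unity: the extra weight shifts the exponent to m + 1, so only
  m = n - 1 survives, where \<open>g (n - 1)\<close> is the inverse of the generator.\<close>

lemma sum_roots_twisted_kernel:
  defines "\<zeta> \<equiv> cis (2 * pi / n)"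
  shows "(\<Sum>j<n. \<zeta> ^ j * (\<Sum>b\<in>L_class e. twisted_kernel n (\<zeta> ^ j) g s b b))
    = of_nat (card {b \<in> L_class e. s * b * g (n - 1) = b})"
proof -
  have orth: "(\<Sum>j<n. (\<zeta> ^ j) * (\<zeta> ^ j) ^ m) = (if m = n - 1 then of_nat n else 0)"
    if m: "m < n" for m
  proof -
    have "(\<Sum>j<n. (\<zeta> ^ j) * (\<zeta> ^ j) ^ m) = (\<Sum>j<n. (\<zeta> ^ Suc m) ^ j)"
      by (simp add: power_mult_distrib power_mult[symmetric] mult.commute)
    also have "\<dots> = (if m = n - 1 then of_nat n else 0)"
    proof (cases "m = n - 1")
      case True
      then have "\<zeta> ^ Suc m = 1" using n_pos by (simp add: \<zeta>_def DeMoivre del: power_Suc)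
      then have "(\<Sum>j<n. (\<zeta> ^ Suc m) ^ j) = of_nat n" by (simp only: power_one) simp
      then show ?thesis by (simp only: True if_True simp_thms)
    next
      case False
      then have "Suc m < n" using m by simp
      have "\<zeta> ^ Suc m \<noteq> 1"
      proof
        assume "\<zeta> ^ Suc m = 1"
        then have "cis (2 * pi * real (Suc m) / real n) = cis (2 * pi * real 0 / real n)"
          by (simp add: \<zeta>_def DeMoivre mult_ac del: power_Suc of_nat_Suc)
        then have "Suc m = 0"
          using \<open>Suc m < n\<close> n_pos
          by (intro inj_onD[OF bij_betw_imp_inj_on[OF bij_betw_roots_unity[OF n_pos]]]) simp_all
        then show False by simp
      qed
      moreover have "(\<zeta> ^ Suc m) ^ n = 1"
      proof -
        have "\<zeta> ^ n = 1" using n_pos by (simp add: \<zeta>_def DeMoivre)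
        then show ?thesis by (metis power_mult mult.commute power_one)
      qed
      ultimately show ?thesis using False by (simp add: geometric_sum)
    qed
    finally show ?thesis .
  qed
  have "(\<Sum>j<n. \<zeta> ^ j * (\<Sum>b\<in>L_class e. twisted_kernel n (\<zeta> ^ j) g s b b)) * of_nat n
    = (\<Sum>j<n. \<Sum>b\<in>L_class e. \<Sum>m<n. (\<zeta> ^ j) * (\<zeta> ^ j) ^ m * of_bool (s * b * g m = b))"
    by (simp only: sum_distrib_left sum_distrib_right mult.assoc twisted_kernel_times_n)
  also have "\<dots> = (\<Sum>b\<in>L_class e. \<Sum>m<n. \<Sum>j<n. (\<zeta> ^ j) * (\<zeta> ^ j) ^ m * of_bool (s * b * g m = b))"
    by (subst sum.swap, rule sum.cong[OF refl], rule sum.swap)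
  also have "\<dots> = (\<Sum>b\<in>L_class e. \<Sum>m<n. if m = n - 1 then of_nat n * of_bool (s * b * g m = b) else 0)"
    by (intro sum.cong refl) (simp add: sum_distrib_right[symmetric] orth del: sum_mult_of_bool_eq)
  also have "\<dots> = (\<Sum>b\<in>L_class e. of_nat n * of_bool (s * b * g (n - 1) = b))"
    using n_pos by (simp add: sum.delta)
  also have "\<dots> = of_nat (card {b \<in> L_class e. s * b * g (n - 1) = b}) * of_nat n"
    using fin by (simp add: sum_distrib_left[symmetric] of_bool_def sum.If_cases Int_def mult.commute)
  finally show ?thesis using n_pos by simp
qed

lemma char_conj_imp_card_eq:
  assumes "x \<equiv>\<^sub>\<chi> y"
  shows "card {b \<in> L_class e. x * b * g (n - 1) = b} = card {b \<in> L_class e. y * b * g (n - 1) = b}"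
proof -
  have "(cis (2 * pi / n) ^ j) ^ n = 1" for j
  proof -
    have "cis (2 * pi / n) ^ n = 1" using n_pos by (simp add: DeMoivre)
    then show ?thesis by (metis power_mult mult.commute power_one)
  qed
  then have "(of_nat (card {b \<in> L_class e. x * b * g (n - 1) = b}) :: complex)
      = of_nat (card {b \<in> L_class e. y * b * g (n - 1) = b})"
    unfolding sum_roots_twisted_kernel[symmetric]
    by (simp only: char_conj_imp_sum_twisted_kernel_eq[OF _ assms])
  then show ?thesis by (simp only: of_nat_eq_iff)
qed

end

lemma char_conj_imp_intertwiner:
  fixes e x y z :: "'a::semigroup_mult"
  assumes fin: "finite (L_class e)" and x: "group_elem e x z" and xy: "x \<equiv>\<^sub>\<chi> y"
  obtains l where "l \<in> L_class e" "y * l = l * x"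
proof -
  have e: "e * e = e" "e * x = x" "x * e = x" "z * x = e" "x * z = e"
    using x by (auto simp: group_elem_def)
  define g where "g m = ((*) x ^^ m) e" for m
  have g_Suc: "g (Suc m) = x * g m" for m by (simp add: g_def)
  have g_0: "g 0 = e" by (simp add: g_def)
  have eg: "e * g m = g m" for m
    by (induction m) (simp_all add: g_0 g_Suc e mult.assoc[symmetric])
  have g_add: "g (m + k) = g m * g k" for m k
    by (induction m) (simp_all add: g_0 g_Suc eg mult.assoc)
  have left_inv: "\<exists>u. u * g m = e" for m
  proof (induction m)
    case (Suc m)
    then obtain u where "u * g m = e" by blast
    then have "(u * z) * g (Suc m) = e"
      by (metis g_Suc e(4) eg mult.assoc)
    then show ?case by blast
  qed (use g_0 e in auto)
  have "range g \<subseteq> L_class e"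
    using left_inv g_add[of _ 0] by (auto simp: L_class_def g_0)
  \<comment> \<open>Pigeonhole in the finite L-class; cancelling \<open>g i\<close> on the left
    turns a repetition into a period.\<close>
  then have "\<not> inj g" using fin finite_subset finite_imageD infinite_UNIV_nat by metis
  then obtain i j where "g i = g j" "i < j" by (metis injI linorder_neqE_nat)
  then have "g i = g i * g (j - i)" using g_add[of i "j - i"] by simp
  then have n: "g (j - i) = e" using left_inv[of i] by (metis mult.assoc eg)
  define n where "n = j - i"
  have "n > 0" using \<open>i < j\<close> by (simp add: n_def)
  interpret cyclic_subgroup e g n
    using \<open>n > 0\<close> n g_0 g_add fin by unfold_locales (simp_all add: n_def)
  have gx: "g (n - 1) * x = e" "x * g (n - 1) = e"
    using g_Suc[of "n - 1"] g_add[of "n - 1" 1] g_Suc[of 0] g_n n_pos g_0 e by simp_all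
  have "e \<in> {b \<in> L_class e. x * b * g (n - 1) = b}"
    using gx e by (auto simp: L_class_def)
  then have "card {b \<in> L_class e. x * b * g (n - 1) = b} > 0"
    using fin by (auto simp: card_gt_0_iff)
  then have "{b \<in> L_class e. y * b * g (n - 1) = b} \<noteq> {}"
    using char_conj_imp_card_eq[OF xy] by (metis card.empty less_irrefl)
  then obtain l where l: "l \<in> L_class e" "y * l * g (n - 1) = l" by blast
  then have "l * e = l" by (auto simp: L_class_def)
  then have "y * l = l * x" using l(2) gx by (metis mult.assoc)
  then show thesis using that l by blast
qed

section \<open>From intertwiners to conjugacy\<close>

text \<open>Let g be the identity of a subgroup containing a power of b. Then f is a left multiple
  of that power, so f g = f; and g lies in bS, so f g = g. Hence f = g lies in bS.\<close>

lemma left_inverse_imp_right_inverse: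
  assumes "group_bound_element (b::'a::semigroup_mult)"
    and f: "f * b = b" "a * b = f"
  obtains c where "f = b * c"
proof -
  obtain k g q where k: "k \<ge> 1" and "group_elem g (semigroup_power b k) q"
    using assms(1) by (rule group_bound_elementE)
  then have g: "semigroup_power b k * g = semigroup_power b k" "semigroup_power b k * q = g"
    by (auto simp: group_elem_def)
  \<comment> \<open>Here \<open>d q\<close> stands for the power with one factor b fewer, times q;
    for k = 1 it is q.\<close>
  have "(\<exists>c. c * semigroup_power b k = f) \<and> (\<exists>d. \<forall>q. semigroup_power b k * q = b * d q)"
    using k
  proof (induction k rule: dec_induct)
    case base
    then show ?case using f by auto
  next
    case (step k)
    then obtain c where "c * semigroup_power b k = f" by blast
    then have "(a * c) * semigroup_power b (Suc k) = f"
      using step.hyps f by (metis semigroup_power_Suc mult.assoc)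
    moreover have "semigroup_power b (Suc k) * q = b * (semigroup_power b k * q)" for q
      using step.hyps by (simp add: semigroup_power_Suc' mult.assoc)
    ultimately show ?case by blast
  qed
  then obtain c d where c: "c * semigroup_power b k = f"
    and d: "\<And>q. semigroup_power b k * q = b * d q" by blast
  have "f * g = f" using c g(1) by (metis mult.assoc)
  moreover have "f * g = g" using d[of q] g(2) f(1) by (metis mult.assoc)
  ultimately have "f = b * d q" using d[of q] g(2) by simp
  then show thesis using that by blast
qed

lemma intertwiners_imp_conj:
  fixes x y :: "'a::semigroup_mult"
  assumes gb: "group_bound_element (l * m)"
    and x: "group_elem e x z" and y: "group_elem f y z'"
    and l: "l \<in> L_class e" "y * l = l * x"
    and m: "m \<in> L_class f" "x * m = m * y"
  shows "x \<sim> y"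
proof -
  have e: "e * x = x" "x * z = e" using x by (auto simp: group_elem_def)
  have f: "f * y = y" "y * z' = f" using y by (auto simp: group_elem_def)
  obtain u where u: "l * e = l" "u * l = e" using l(1) by (auto simp: L_class_def)
  obtain v where v: "m * f = m" "v * m = f" using m(1) by (auto simp: L_class_def)
  \<comment> \<open>l = l x z = y l z lies in yS, where f acts as a left identity.\<close>
  have fl: "f * l = l" using l(2) u(1) e f by (metis mult.assoc)
  have em: "e * m = m" using m(2) v(1) e f by (metis mult.assoc)
  have "f * (l * m) = l * m" using fl by (simp add: mult.assoc[symmetric])
  moreover have "(v * u) * (l * m) = f" using u(2) em v(2) by (metis mult.assoc)
  ultimately obtain c where c: "f = l * m * c"
    using left_inverse_imp_right_inverse[OF gb] by blast
  \<comment> \<open>As l u l = l e = l, the product l u fixes lS, which contains f.\<close>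
  then have luf: "l * u * f = f" using u by (metis mult.assoc)
  have "x = u * (y * l)" using l(2) u(2) e(1) by (metis mult.assoc)
  also have "u * (y * l) \<sim> (y * l) * u" by (rule semigroup_conj_mult)
  also have "(y * l) * u = y * (l * u)" by (simp add: mult.assoc)
  also have "\<dots> \<sim> (l * u) * y" by (rule semigroup_conj_mult)
  also have "(l * u) * y = y" using luf f(1) by (metis mult.assoc)
  finally show ?thesis .
qed

theorem theorem2:
  fixes x y :: "'a::semigroup_mult"
  assumes regular: "\<And>a::'a. regular_element a"
    and group_bound: "\<And>a::'a. group_bound_element a"
    and finite_D_classes: "\<And>a::'a. finite {b. green_D a b}"
  shows "x \<sim> y \<longleftrightarrow> x \<equiv>\<^sub>\<chi> y"
proof
  assume "x \<sim> y"
  then show "x \<equiv>\<^sub>\<chi> y" by (rule semigroup_conj_imp_char_conj)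
next
  assume xy: "x \<equiv>\<^sub>\<chi> y"
  have fin: "finite (L_class a)" for a :: 'a
    using finite_D_classes finite_subset[OF L_class_subset_green_D] by blast
  obtain e x' z where x': "x \<sim> x'" "group_elem e x' z"
    using semigroup_conj_group_elem[OF regular group_bound] by blast
  obtain f y' z' where y': "y \<sim> y'" "group_elem f y' z'"
    using semigroup_conj_group_elem[OF regular group_bound] by blast
  have x'y': "x' \<equiv>\<^sub>\<chi> y'"
    using x'(1) y'(1) xy semigroup_conj_imp_char_conj char_conj_sym char_conj_trans by metis
  obtain l where l: "l \<in> L_class e" "y' * l = l * x'"
    using char_conj_imp_intertwiner[OF fin x'(2) x'y'] by blast
  obtain m where m: "m \<in> L_class f" "x' * m = m * y'"
    using char_conj_imp_intertwiner[OF fin y'(2) char_conj_sym[OF x'y']] by blast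
  have "x' \<sim> y'" using intertwiners_imp_conj[OF group_bound x'(2) y'(2) l m] .
  then show "x \<sim> y" using x'(1) y'(1) semigroup_conj_sym semigroup_conj_trans by metis
qed

end
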